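(* Let $Y=\{0,1\}^{\mathbb Z}$, let $\sigma\colon Y\to Y$ be the shift $(\sigma(\alpha))_i=\alpha_{i+1}$, and for $n\ge 0$ let $U_n=\{\alpha\in Y\mid\alpha_i=0\text{ for }|i|<n\}$ (so $U_0=Y$). Let $X=\{(n,\alpha)\in\mathbb N\times Y\mid\alpha\in U_n\}$ and define partial homeomorphisms $f,g$ of $X$ by $f(n,\alpha)=(n,\sigma(\alpha))$ with $\mathrm{dom} f=\{(n,\alpha)\in X\mid\sigma(\alpha)\in U_n\setminus U_{n+2}\}$, and $g(n,\alpha)=(n+1,\alpha)$ with $\mathrm{dom}\,g=\{(n,\alpha)\in X\mid\alpha\in U_{n+1}\}$. Let $\mathcal G$ be the pseudogroup on $X$ generated by $f$ and $g$. Then $\mathcal G$ is topologically transitive and has density of periodic orbits.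
   Context: $\mathbb N$ contains $0$ and is discrete; $Y$ has the product topology and $X$ the subspace topology of $\mathbb N\times Y$. $\mathrm{Ph}(X)$ is the set of partial homeomorphisms of $X$, i.e. homeomorphisms $f\colon\mathrm{dom} f\to\mathrm{im} f$ between open subsets of $X$; the composition $gf$ has domain $f^{-1}(\mathrm{dom}\,g)$. A pseudogroup on $X$ is a subset $\mathcal G\subset\mathrm{Ph}(X)$ containing $\mathrm{id}_X$, closed under inversion, composition and restriction to open subsets of domains, and such that if $f\in\mathrm{Ph}(X)$ and every $x\in\mathrm{dom} f$ has an open neighborhood $U_x$ with $f|_{U_x}\in\mathcal G$, then $f\in\mathcal G$. The pseudogroup generated by a set of partial homeomorphisms is the smallest pseudogroup containing it. The orbit of $x$ is $\mathcal Gx=\{hx\mid h\in\mathcal G,\ x\in\mathrm{dom}\,h\}$, and for open $U\subset X$, $\mathcal G|_U=\{h\in\mathcal G\mid\mathrm{dom}\,h,\mathrm{im}\,h\subset U\}$. $\mathcal G$ is topologically transitive if for all non-empty open $U,V\subset X$ there is $h\in\mathcal G$ with $h(U\cap\mathrm{dom}\,h)\cap V\ne\emptyset$. $\mathcal G$ has density of periodic orbits if there is an open $U\subset X$ meeting every $\mathcal G$-orbit such that the union of the finite $\mathcal G|_U$-orbits is dense in $U$. *)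

theory Defs
  imports "HOL-Analysis.Analysis"
begin

text \<open>Partial maps are represented by the type \<^typ>\<open>'a \<rightharpoonup> 'a\<close>, with
  \<^const>\<open>dom\<close> and \<^const>\<open>ran\<close> as domain and image; a partial map is thus determined by its graph.
  The composition \<open>g \<circ>\<^sub>m f\<close> has domain \<open>f\<^sup>-\<^sup>1 (dom g)\<close>.\<close>

definition partial_homeos :: "'a topology \<Rightarrow> ('a \<rightharpoonup> 'a) set" where
  "partial_homeos X = {f. openin X (dom f) \<and> openin X (ran f) \<and>
     homeomorphic_map (subtopology X (dom f)) (subtopology X (ran f)) (\<lambda>x. the (f x))}"

text \<open>Meaningful for \<open>f\<close> injective on its domain.\<close>

definition pinv :: "('a \<rightharpoonup> 'a) \<Rightarrow> ('a \<rightharpoonup> 'a)" where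
  "pinv f = (\<lambda>y. if y \<in> ran f then Some (THE x. f x = Some y) else None)"

definition pseudogroup :: "'a topology \<Rightarrow> ('a \<rightharpoonup> 'a) set \<Rightarrow> bool" where
  "pseudogroup X G \<longleftrightarrow>
     G \<subseteq> partial_homeos X \<and>
     Some |` topspace X \<in> G \<and>
     (\<forall>f\<in>G. pinv f \<in> G) \<and>
     (\<forall>f\<in>G. \<forall>g\<in>G. g \<circ>\<^sub>m f \<in> G) \<and>
     (\<forall>f\<in>G. \<forall>W. openin X W \<and> W \<subseteq> dom f \<longrightarrow> f |` W \<in> G) \<and>
     (\<forall>f\<in>partial_homeos X.
        (\<forall>x\<in>dom f. \<exists>W. openin X W \<and> x \<in> W \<and> W \<subseteq> dom f \<and> f |` W \<in> G) \<longrightarrow> f \<in> G)"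

text \<open>For \<open>S \<subseteq> partial_homeos X\<close> this is the smallest pseudogroup containing \<open>S\<close>
  (see \<open>pseudogroup_generated_by\<close> below).\<close>

definition generated_by :: "'a topology \<Rightarrow> ('a \<rightharpoonup> 'a) set \<Rightarrow> ('a \<rightharpoonup> 'a) set" where
  "generated_by X S = \<Inter> {G. pseudogroup X G \<and> S \<subseteq> G}"

definition orbit_of :: "('a \<rightharpoonup> 'a) set \<Rightarrow> 'a \<Rightarrow> 'a set" where
  "orbit_of G x = {the (h x) | h. h \<in> G \<and> x \<in> dom h}"

definition pg_restrict :: "('a \<rightharpoonup> 'a) set \<Rightarrow> 'a set \<Rightarrow> ('a \<rightharpoonup> 'a) set" where
  "pg_restrict G U = {h \<in> G. dom h \<subseteq> U \<and> ran h \<subseteq> U}"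

definition topologically_transitive :: "'a topology \<Rightarrow> ('a \<rightharpoonup> 'a) set \<Rightarrow> bool" where
  "topologically_transitive X G \<longleftrightarrow>
     (\<forall>U V. openin X U \<and> U \<noteq> {} \<and> openin X V \<and> V \<noteq> {} \<longrightarrow>
        (\<exists>h\<in>G. (\<lambda>x. the (h x)) ` (U \<inter> dom h) \<inter> V \<noteq> {}))"

definition density_of_periodic_orbits :: "'a topology \<Rightarrow> ('a \<rightharpoonup> 'a) set \<Rightarrow> bool" where
  "density_of_periodic_orbits X G \<longleftrightarrow>
     (\<exists>U. openin X U \<and> (\<forall>x\<in>topspace X. orbit_of G x \<inter> U \<noteq> {}) \<and>
        subtopology X U closure_of
          (\<Union>{C. \<exists>x\<in>U. C = orbit_of (pg_restrict G U) x \<and> finite C}) = U)"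

definition Y_top :: "(int \<Rightarrow> nat) topology" where
  "Y_top = product_topology (\<lambda>_. discrete_topology {0, 1}) UNIV"

definition shift :: "(int \<Rightarrow> nat) \<Rightarrow> (int \<Rightarrow> nat)" where
  "shift \<alpha> = (\<lambda>i. \<alpha> (i + 1))"

definition U_set :: "nat \<Rightarrow> (int \<Rightarrow> nat) set" where
  "U_set n = {\<alpha> \<in> topspace Y_top. \<forall>i. \<bar>i\<bar> < int n \<longrightarrow> \<alpha> i = 0}"

definition X_set :: "(nat \<times> (int \<Rightarrow> nat)) set" where
  "X_set = {(n, \<alpha>). \<alpha> \<in> U_set n}"

definition X_top :: "(nat \<times> (int \<Rightarrow> nat)) topology" where
  "X_top = subtopology (prod_topology (discrete_topology UNIV) Y_top) X_set"

definition f_map :: "nat \<times> (int \<Rightarrow> nat) \<rightharpoonup> nat \<times> (int \<Rightarrow> nat)" where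
  "f_map = (\<lambda>(n, \<alpha>). if (n, \<alpha>) \<in> X_set \<and> shift \<alpha> \<in> U_set n - U_set (n + 2)
                     then Some (n, shift \<alpha>) else None)"

definition g_map :: "nat \<times> (int \<Rightarrow> nat) \<rightharpoonup> nat \<times> (int \<Rightarrow> nat)" where
  "g_map = (\<lambda>(n, \<alpha>). if (n, \<alpha>) \<in> X_set \<and> \<alpha> \<in> U_set (n + 1)
                     then Some (n + 1, \<alpha>) else None)"

definition G_pg :: "(nat \<times> (int \<Rightarrow> nat) \<rightharpoonup> nat \<times> (int \<Rightarrow> nat)) set" where
  "G_pg = generated_by X_top {f_map, g_map}"

lemma partial_homeos_iff:
  "f \<in> partial_homeos X \<longleftrightarrow>
     dom f \<subseteq> topspace X \<and> ran f \<subseteq> topspace X \<and>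
     (\<forall>x x' y. f x = Some y \<longrightarrow> f x' = Some y \<longrightarrow> x = x') \<and>
     (\<forall>V. openin X V \<longrightarrow> openin X {x. \<exists>y\<in>V. f x = Some y}) \<and>
     (\<forall>V. openin X V \<longrightarrow> openin X {y. \<exists>x\<in>V. f x = Some y})" (is "?L \<longleftrightarrow> ?R")
proof
  assume L: ?L
  have od: "openin X (dom f)" and orr: "openin X (ran f)" and
    h: "homeomorphic_map (subtopology X (dom f)) (subtopology X (ran f)) (\<lambda>x. the (f x))"
    using L by (auto simp: partial_homeos_def)
  have ds: "dom f \<subseteq> topspace X" and rs: "ran f \<subseteq> topspace X"
    using od orr by (auto dest: openin_subset)
  have inj: "inj_on (\<lambda>x. the (f x)) (dom f)"
    using h ds by (auto simp: homeomorphic_eq_everything_map Int_absorb1)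
  have cont: "continuous_map (subtopology X (dom f)) (subtopology X (ran f)) (\<lambda>x. the (f x))"
    and opn: "open_map (subtopology X (dom f)) (subtopology X (ran f)) (\<lambda>x. the (f x))"
    using h by (auto simp: homeomorphic_eq_everything_map)
  show ?R
  proof (intro conjI allI impI ds rs)
    fix x x' y assume "f x = Some y" "f x' = Some y"
    then show "x = x'" using inj by (auto simp: inj_on_def dom_def)
  next
    fix V assume V: "openin X V"
    have "openin (subtopology X (ran f)) (V \<inter> ran f)"
      using V by (auto simp: openin_subtopology)
    then have "openin (subtopology X (dom f))
        {x \<in> topspace (subtopology X (dom f)). the (f x) \<in> V \<inter> ran f}"
      using cont unfolding continuous_map_def by blast
    moreover have "{x \<in> topspace (subtopology X (dom f)). the (f x) \<in> V \<inter> ran f}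
        = {x. \<exists>y\<in>V. f x = Some y}"
      using ds by (auto simp: ran_def dom_def)
    ultimately show "openin X {x. \<exists>y\<in>V. f x = Some y}"
      using od by (simp add: openin_open_subtopology)
  next
    fix V assume V: "openin X V"
    have "openin (subtopology X (dom f)) (V \<inter> dom f)"
      using V by (auto simp: openin_subtopology)
    then have "openin (subtopology X (ran f)) ((\<lambda>x. the (f x)) ` (V \<inter> dom f))"
      using opn unfolding open_map_def by blast
    moreover have "(\<lambda>x. the (f x)) ` (V \<inter> dom f) = {y. \<exists>x\<in>V. f x = Some y}"
    proof (intro equalityI subsetI)
      fix y assume "y \<in> {y. \<exists>x\<in>V. f x = Some y}"
      then obtain x where "x \<in> V" "f x = Some y" by blast
      then show "y \<in> (\<lambda>x. the (f x)) ` (V \<inter> dom f)" by (intro image_eqI[of _ _ x]) auto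
    qed auto
    ultimately show "openin X {y. \<exists>x\<in>V. f x = Some y}"
      using orr by (simp add: openin_open_subtopology)
  qed
next
  assume R: ?R
  then have ds: "dom f \<subseteq> topspace X" and rs: "ran f \<subseteq> topspace X" by simp_all
  have inj: "x = x'" if "f x = Some y" "f x' = Some y" for x x' y
    using R[THEN conjunct2, THEN conjunct2, THEN conjunct1] that by blast
  have pre: "openin X {x. \<exists>y\<in>V. f x = Some y}" if "openin X V" for V
    by (rule R[THEN conjunct2, THEN conjunct2, THEN conjunct2, THEN conjunct1, rule_format, OF that])
  have img: "openin X {y. \<exists>x\<in>V. f x = Some y}" if "openin X V" for V
    by (rule R[THEN conjunct2, THEN conjunct2, THEN conjunct2, THEN conjunct2, rule_format, OF that])
  have "{x. \<exists>y\<in>topspace X. f x = Some y} = dom f"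
    using rs by (auto intro: ranI)
  then have od: "openin X (dom f)" using pre[OF openin_topspace] by simp
  have "{y. \<exists>x\<in>topspace X. f x = Some y} = ran f"
    using ds unfolding ran_def dom_def by blast
  then have orr: "openin X (ran f)" using img[OF openin_topspace] by simp
  have im: "(\<lambda>x. the (f x)) ` V = {y. \<exists>x\<in>V. f x = Some y}" if V: "V \<subseteq> dom f" for V
  proof (intro equalityI subsetI)
    fix y assume "y \<in> {y. \<exists>x\<in>V. f x = Some y}"
    then obtain x where "x \<in> V" "f x = Some y" by blast
    then show "y \<in> (\<lambda>x. the (f x)) ` V" by (intro image_eqI[of _ _ x]) auto
  next
    fix y assume "y \<in> (\<lambda>x. the (f x)) ` V"
    then obtain x where x: "x \<in> V" "y = the (f x)" by blast
    with V have "f x = Some y" by auto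
    with x show "y \<in> {y. \<exists>x\<in>V. f x = Some y}" by blast
  qed
  have ts: "topspace (subtopology X (dom f)) = dom f" "topspace (subtopology X (ran f)) = ran f"
    using ds rs by auto
  have "continuous_map (subtopology X (dom f)) (subtopology X (ran f)) (\<lambda>x. the (f x))"
    unfolding continuous_map_def ts
  proof (intro conjI allI impI)
    show "(\<lambda>x. the (f x)) \<in> dom f \<rightarrow> ran f"
      by (auto simp: ran_def dom_def)
  next
    fix V assume "openin (subtopology X (ran f)) V"
    then have V: "openin X V" using orr by (simp add: openin_open_subtopology)
    have "{x \<in> dom f. the (f x) \<in> V} = {x. \<exists>y\<in>V. f x = Some y}"
      by (auto simp: dom_def)
    moreover have "{x \<in> dom f. the (f x) \<in> V} \<subseteq> dom f" by blast
    ultimately show "openin (subtopology X (dom f)) {x \<in> dom f. the (f x) \<in> V}"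
      using pre[OF V] od by (simp add: openin_open_subtopology)
  qed
  moreover have "open_map (subtopology X (dom f)) (subtopology X (ran f)) (\<lambda>x. the (f x))"
    unfolding open_map_def
  proof (intro allI impI)
    fix V assume "openin (subtopology X (dom f)) V"
    then have V: "openin X V" "V \<subseteq> dom f" using od by (simp_all add: openin_open_subtopology)
    have "{y. \<exists>x\<in>V. f x = Some y} \<subseteq> ran f" by (auto simp: ran_def)
    then show "openin (subtopology X (ran f)) ((\<lambda>x. the (f x)) ` V)"
      using img[OF V(1)] orr unfolding im[OF V(2)] by (simp add: openin_open_subtopology)
  qed
  moreover have "(\<lambda>x. the (f x)) ` dom f = ran f"
    unfolding im[OF subset_refl] by (auto simp: ran_def)
  moreover have "inj_on (\<lambda>x. the (f x)) (dom f)"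
    using inj by (auto simp: inj_on_def dom_def)
  ultimately have "homeomorphic_map (subtopology X (dom f)) (subtopology X (ran f)) (\<lambda>x. the (f x))"
    by (intro bijective_open_imp_homeomorphic_map) (simp_all only: ts)
  then show ?L
    using od orr by (simp add: partial_homeos_def)
qed

lemma partial_homeos_dest:
  assumes "f \<in> partial_homeos X"
  shows partial_homeos_dom: "dom f \<subseteq> topspace X" and partial_homeos_ran: "ran f \<subseteq> topspace X"
    and partial_homeos_inj: "f x = Some y \<Longrightarrow> f x' = Some y \<Longrightarrow> x = x'"
    and partial_homeos_preimage: "openin X V \<Longrightarrow> openin X {x. \<exists>y\<in>V. f x = Some y}"
    and partial_homeos_image: "openin X V \<Longrightarrow> openin X {y. \<exists>x\<in>V. f x = Some y}"
  using assms unfolding partial_homeos_iff by simp_all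

lemma pinv_eq_Some_iff:
  assumes "f \<in> partial_homeos X"
  shows "pinv f y = Some x \<longleftrightarrow> f x = Some y"
proof -
  have inj: "\<And>x x' y. f x = Some y \<Longrightarrow> f x' = Some y \<Longrightarrow> x = x'"
    by (rule partial_homeos_inj[OF assms])
  have "(THE x. f x = Some y) = x" if "f x = Some y" for x
    using that inj by blast
  then show ?thesis by (auto simp: pinv_def ran_def)
qed

lemma pseudogroup_partial_homeos: "pseudogroup X (partial_homeos X)"
  unfolding pseudogroup_def
proof (intro conjI ballI allI impI subset_refl)
  have *: "{x. \<exists>y\<in>V. (Some |` topspace X) x = Some y} = V"
    "{y. \<exists>x\<in>V. (Some |` topspace X) x = Some y} = V" if "openin X V" for V
    using openin_subset[OF that] by (auto simp: restrict_map_def split: if_splits)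
  show "Some |` topspace X \<in> partial_homeos X"
    by (auto simp: partial_homeos_iff * dom_def ran_def)
      (auto simp: restrict_map_def split: if_splits)
next
  fix f assume f: "f \<in> partial_homeos X"
  have e: "\<And>x y. pinv f y = Some x \<longleftrightarrow> f x = Some y" using pinv_eq_Some_iff[OF f] .
  show "pinv f \<in> partial_homeos X"
    unfolding partial_homeos_iff e
  proof (intro conjI allI impI)
    have "dom (pinv f) = ran f" "ran (pinv f) = dom f" by (auto simp: dom_def ran_def e)
    then show "dom (pinv f) \<subseteq> topspace X" "ran (pinv f) \<subseteq> topspace X"
      using partial_homeos_dom[OF f] partial_homeos_ran[OF f] by simp_all
  qed (use partial_homeos_preimage[OF f] partial_homeos_image[OF f] in simp_all)
next
  fix f g assume f: "f \<in> partial_homeos X" and g: "g \<in> partial_homeos X"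
  show "g \<circ>\<^sub>m f \<in> partial_homeos X"
    unfolding partial_homeos_iff
  proof (intro conjI allI impI)
    have "dom (g \<circ>\<^sub>m f) \<subseteq> dom f" "ran (g \<circ>\<^sub>m f) \<subseteq> ran g"
      by (auto simp: map_comp_Some_iff ran_def)
    then show "dom (g \<circ>\<^sub>m f) \<subseteq> topspace X" "ran (g \<circ>\<^sub>m f) \<subseteq> topspace X"
      using partial_homeos_dom[OF f] partial_homeos_ran[OF g] by simp_all
    show "x = x'" if xx: "(g \<circ>\<^sub>m f) x = Some y" "(g \<circ>\<^sub>m f) x' = Some y" for x x' y
    proof -
      obtain z z' where "f x = Some z" "g z = Some y" "f x' = Some z'" "g z' = Some y"
        using xx by (auto simp: map_comp_Some_iff)
      then show ?thesis using partial_homeos_inj[OF f] partial_homeos_inj[OF g, of z y z'] by blast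
    qed
    fix V assume V: "openin X V"
    have "{x. \<exists>y\<in>V. (g \<circ>\<^sub>m f) x = Some y} = {x. \<exists>z\<in>{z. \<exists>y\<in>V. g z = Some y}. f x = Some z}"
      by (auto simp: map_comp_Some_iff)
    then show "openin X {x. \<exists>y\<in>V. (g \<circ>\<^sub>m f) x = Some y}"
      using partial_homeos_preimage[OF f partial_homeos_preimage[OF g V]] by (simp only:)
    have "{y. \<exists>x\<in>V. (g \<circ>\<^sub>m f) x = Some y} = {y. \<exists>z\<in>{z. \<exists>x\<in>V. f x = Some z}. g z = Some y}"
      by (auto simp: map_comp_Some_iff)
    then show "openin X {y. \<exists>x\<in>V. (g \<circ>\<^sub>m f) x = Some y}"
      using partial_homeos_image[OF g partial_homeos_image[OF f V]] by (simp only:)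
  qed
next
  fix f W assume f: "f \<in> partial_homeos X" and W: "openin X W \<and> W \<subseteq> dom f"
  have r: "(f |` W) x = Some y \<longleftrightarrow> x \<in> W \<and> f x = Some y" for x y
    by (simp add: restrict_map_def)
  show "f |` W \<in> partial_homeos X"
    unfolding partial_homeos_iff r
  proof (intro conjI allI impI)
    have "dom (f |` W) \<subseteq> dom f" "ran (f |` W) \<subseteq> ran f" by (auto simp: r ran_def)
    then show "dom (f |` W) \<subseteq> topspace X" "ran (f |` W) \<subseteq> topspace X"
      using partial_homeos_dom[OF f] partial_homeos_ran[OF f] by blast+
    show "x = x'" if "x \<in> W \<and> f x = Some y" "x' \<in> W \<and> f x' = Some y" for x x' y
      using that partial_homeos_inj[OF f, of x y x'] by simp
    fix V assume V: "openin X V"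
    have WV: "openin X (W \<inter> V)" using V W by (simp add: openin_Int)
    have "{x. \<exists>y\<in>V. x \<in> W \<and> f x = Some y} = W \<inter> {x. \<exists>y\<in>V. f x = Some y}" by auto
    then show "openin X {x. \<exists>y\<in>V. x \<in> W \<and> f x = Some y}"
      using partial_homeos_preimage[OF f V] W by (simp add: openin_Int)
    have "{y. \<exists>x\<in>V. x \<in> W \<and> f x = Some y} = {y. \<exists>x\<in>W \<inter> V. f x = Some y}" by auto
    then show "openin X {y. \<exists>x\<in>V. x \<in> W \<and> f x = Some y}"
      using partial_homeos_image[OF f WV] by (simp only:)
  qed
qed

lemma pseudogroup_dest:
  assumes "pseudogroup X G"
  shows pseudogroup_subset: "G \<subseteq> partial_homeos X"
    and pseudogroup_id: "Some |` topspace X \<in> G"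
    and pseudogroup_pinv: "f \<in> G \<Longrightarrow> pinv f \<in> G"
    and pseudogroup_comp: "f \<in> G \<Longrightarrow> g \<in> G \<Longrightarrow> g \<circ>\<^sub>m f \<in> G"
    and pseudogroup_restrict: "f \<in> G \<Longrightarrow> openin X W \<Longrightarrow> W \<subseteq> dom f \<Longrightarrow> f |` W \<in> G"
    and pseudogroup_local: "f \<in> partial_homeos X \<Longrightarrow>
      (\<And>x. x \<in> dom f \<Longrightarrow> \<exists>W. openin X W \<and> x \<in> W \<and> W \<subseteq> dom f \<and> f |` W \<in> G) \<Longrightarrow> f \<in> G"
  using assms unfolding pseudogroup_def by simp_all

lemma pseudogroup_generated_by:
  assumes "S \<subseteq> partial_homeos X"
  shows "pseudogroup X (generated_by X S)" and "S \<subseteq> generated_by X S"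
    and "pseudogroup X G \<Longrightarrow> S \<subseteq> G \<Longrightarrow> generated_by X S \<subseteq> G"
proof -
  have I: "h \<in> generated_by X S" if "\<And>G. pseudogroup X G \<Longrightarrow> S \<subseteq> G \<Longrightarrow> h \<in> G" for h
    unfolding generated_by_def using that by blast
  have E: "h \<in> G" if "h \<in> generated_by X S" "pseudogroup X G" "S \<subseteq> G" for h G
    using that unfolding generated_by_def by blast
  show "S \<subseteq> generated_by X S" unfolding generated_by_def by blast
  show "generated_by X S \<subseteq> G" if "pseudogroup X G" "S \<subseteq> G" for G
    using that unfolding generated_by_def by blast
  show "pseudogroup X (generated_by X S)"
    unfolding pseudogroup_def
  proof (intro conjI ballI allI impI)
    show "generated_by X S \<subseteq> partial_homeos X"
      using E[OF _ pseudogroup_partial_homeos assms] by blast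
    show "Some |` topspace X \<in> generated_by X S"
      by (rule I) (rule pseudogroup_id)
    show "pinv f \<in> generated_by X S" if "f \<in> generated_by X S" for f
      by (intro I pseudogroup_pinv E[OF that])
    show "g \<circ>\<^sub>m f \<in> generated_by X S" if "f \<in> generated_by X S" "g \<in> generated_by X S" for f g
      by (intro I pseudogroup_comp E[OF that(1)] E[OF that(2)])
    show "f |` W \<in> generated_by X S"
      if f: "f \<in> generated_by X S" and W: "openin X W \<and> W \<subseteq> dom f" for f W
    proof (rule I)
      fix G assume G: "pseudogroup X G" "S \<subseteq> G"
      show "f |` W \<in> G" using pseudogroup_restrict[OF G(1) E[OF f G]] W by simp
    qed
  next
    fix f assume f: "f \<in> partial_homeos X"
      and l: "\<forall>x\<in>dom f. \<exists>W. openin X W \<and> x \<in> W \<and> W \<subseteq> dom f \<and> f |` W \<in> generated_by X S"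
    show "f \<in> generated_by X S"
    proof (rule I)
      fix G assume G: "pseudogroup X G" "S \<subseteq> G"
      show "f \<in> G"
      proof (rule pseudogroup_local[OF G(1) f])
        fix x assume "x \<in> dom f"
        then obtain W where "openin X W" "x \<in> W" "W \<subseteq> dom f" "f |` W \<in> generated_by X S"
          using l by blast
        then show "\<exists>W. openin X W \<and> x \<in> W \<and> W \<subseteq> dom f \<and> f |` W \<in> G"
          using E[OF _ G] by blast
      qed
    qed
  qed
qed

lemma topspace_Y: "topspace Y_top = {\<alpha>. \<forall>i. \<alpha> i \<in> {0, 1}}"
  by (auto simp: Y_top_def PiE_def Pi_def)

lemma openin_Y_coord: "openin Y_top {\<alpha> \<in> topspace Y_top. \<alpha> i = a}"
proof -
  have "continuous_map Y_top (discrete_topology {0, 1}) (\<lambda>\<alpha>. \<alpha> i)"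
    unfolding Y_top_def by (rule continuous_map_product_projection) simp
  moreover have "openin (discrete_topology {0, 1}) ({a} \<inter> {0, 1})" by simp
  ultimately have "openin Y_top {\<alpha> \<in> topspace Y_top. \<alpha> i \<in> {a} \<inter> {0, 1}}"
    by (rule openin_continuous_map_preimage)
  moreover have "{\<alpha> \<in> topspace Y_top. \<alpha> i \<in> {a} \<inter> {0, 1}} = {\<alpha> \<in> topspace Y_top. \<alpha> i = a}"
    by (auto simp: topspace_Y)
  ultimately show ?thesis by simp
qed

lemma openin_U_set: "openin Y_top (U_set n)" and openin_compl_U_set: "openin Y_top (topspace Y_top - U_set n)"
proof -
  let ?I = "{i::int. \<bar>i\<bar> < int n}"
  have fin: "finite ?I" by (rule finite_subset[of _ "{- int n..int n}"]) auto
  have "U_set n = topspace Y_top \<inter> \<Inter> ((\<lambda>i. {\<alpha> \<in> topspace Y_top. \<alpha> i = 0}) ` ?I)"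
    by (auto simp: U_set_def)
  moreover have "openin Y_top \<dots>"
    using fin by (cases "?I = {}") (auto intro!: openin_Int openin_INT2 openin_Y_coord)
  ultimately show "openin Y_top (U_set n)" by simp
  have "topspace Y_top - U_set n = \<Union> ((\<lambda>i. {\<alpha> \<in> topspace Y_top. \<alpha> i = 1}) ` ?I)"
    by (auto simp: U_set_def topspace_Y)
  moreover have "openin Y_top \<dots>" by (auto intro!: openin_Union openin_Y_coord)
  ultimately show "openin Y_top (topspace Y_top - U_set n)" by simp
qed

abbreviation NY_top :: "(nat \<times> (int \<Rightarrow> nat)) topology" where
  "NY_top \<equiv> prod_topology (discrete_topology (UNIV::nat set)) Y_top"

lemma openin_NY: "openin NY_top V \<longleftrightarrow> (\<forall>n. openin Y_top {\<alpha>. (n, \<alpha>) \<in> V})"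
proof
  assume V: "openin NY_top V"
  show "\<forall>n. openin Y_top {\<alpha>. (n, \<alpha>) \<in> V}"
  proof
    fix n
    have "continuous_map Y_top NY_top (\<lambda>\<alpha>. (n, \<alpha>))" by (auto intro!: continuous_map_pairedI)
    then have "openin Y_top {\<alpha> \<in> topspace Y_top. (n, \<alpha>) \<in> V}"
      using V by (rule openin_continuous_map_preimage)
    moreover have "{\<alpha> \<in> topspace Y_top. (n, \<alpha>) \<in> V} = {\<alpha>. (n, \<alpha>) \<in> V}"
      using openin_subset[OF V] by auto
    ultimately show "openin Y_top {\<alpha>. (n, \<alpha>) \<in> V}" by simp
  qed
next
  assume V: "\<forall>n. openin Y_top {\<alpha>. (n, \<alpha>) \<in> V}"
  have "V = (\<Union>n. {n} \<times> {\<alpha>. (n, \<alpha>) \<in> V})" by auto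
  moreover have "openin NY_top \<dots>" using V by (auto intro!: openin_Union simp: openin_prod_Times_iff)
  ultimately show "openin NY_top V" by simp
qed

lemma openin_X:
  "openin X_top V \<longleftrightarrow> (\<forall>n. openin Y_top {\<alpha>. (n, \<alpha>) \<in> V} \<and> {\<alpha>. (n, \<alpha>) \<in> V} \<subseteq> U_set n)"
proof -
  have "openin NY_top X_set" by (auto simp: openin_NY X_set_def openin_U_set)
  then show ?thesis
    unfolding X_top_def by (auto simp: openin_open_subtopology openin_NY X_set_def)
qed

lemma topspace_X: "topspace X_top = X_set"
  by (auto simp: X_top_def X_set_def U_set_def)

definition unshift :: "(int \<Rightarrow> nat) \<Rightarrow> (int \<Rightarrow> nat)" where
  "unshift \<alpha> = (\<lambda>i. \<alpha> (i - 1))"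

lemma shift_unshift: "shift (unshift \<alpha>) = \<alpha>" "unshift (shift \<alpha>) = \<alpha>"
  by (auto simp: shift_def unshift_def)

lemma shift_Y: "shift \<alpha> \<in> topspace Y_top \<longleftrightarrow> \<alpha> \<in> topspace Y_top"
  unfolding topspace_Y shift_def by (auto, (metis diff_add_cancel)+)

lemma cont_shift: "continuous_map Y_top Y_top shift" "continuous_map Y_top Y_top unshift"
  unfolding shift_def unshift_def Y_top_def
  by (auto simp: continuous_map_componentwise_UNIV intro!: continuous_map_product_projection)

lemma f_Some: "f_map p = Some q \<longleftrightarrow> (\<exists>n \<alpha>. p = (n, \<alpha>) \<and> q = (n, shift \<alpha>) \<and>
   \<alpha> \<in> U_set n \<and> shift \<alpha> \<in> U_set n - U_set (n + 2))"
  by (cases p) (auto simp: f_map_def X_set_def)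

lemma g_Some: "g_map p = Some q \<longleftrightarrow> (\<exists>n \<alpha>. p = (n, \<alpha>) \<and> q = (n + 1, \<alpha>) \<and>
   \<alpha> \<in> U_set n \<and> \<alpha> \<in> U_set (n + 1))"
  by (cases p) (auto simp: g_map_def X_set_def)

lemma open_diff: "openin Y_top (U_set n - U_set m)"
proof -
  have "U_set n - U_set m = U_set n \<inter> (topspace Y_top - U_set m)" by (auto simp: U_set_def)
  then show ?thesis using openin_U_set openin_compl_U_set by (metis openin_Int)
qed

lemma f_map_partial_homeo: "f_map \<in> partial_homeos X_top"
  unfolding partial_homeos_iff
proof (intro conjI allI impI)
  show "dom f_map \<subseteq> topspace X_top" "ran f_map \<subseteq> topspace X_top"
    by (auto simp: topspace_X dom_def ran_def f_Some X_set_def)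
  show "x = x'" if "f_map x = Some y" "f_map x' = Some y" for x x' y
    using that by (auto simp: f_Some) (metis shift_unshift(2))
  fix V assume V: "openin X_top V"
  define A where "A n = {\<alpha>. (n, \<alpha>) \<in> V}" for n
  have A: "openin Y_top (A n)" "A n \<subseteq> U_set n" for n using V by (auto simp: openin_X A_def)
  have U: "U_set n \<subseteq> topspace Y_top" for n by (auto simp: U_set_def)
  have 1: "{\<alpha>. (n, \<alpha>) \<in> {x. \<exists>y\<in>V. f_map x = Some y}} =
     U_set n \<inter> {\<alpha> \<in> topspace Y_top. shift \<alpha> \<in> A n \<inter> (U_set n - U_set (n+2))}" for n
    using U[of n] by (auto simp: f_Some A_def)
  have 2: "{\<alpha>. (n, \<alpha>) \<in> {y. \<exists>x\<in>V. f_map x = Some y}} =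
     (U_set n - U_set (n+2)) \<inter> {\<alpha> \<in> topspace Y_top. unshift \<alpha> \<in> A n}" for n
    using U[of n] A(2)[of n] by (auto simp: f_Some A_def shift_unshift) (metis shift_unshift(1) mem_Collect_eq subsetD)
  have o1: "openin Y_top {\<alpha> \<in> topspace Y_top. shift \<alpha> \<in> A n \<inter> (U_set n - U_set (n+2))}" for n
    by (intro openin_continuous_map_preimage[OF cont_shift(1)] openin_Int A open_diff)
  have o2: "openin Y_top {\<alpha> \<in> topspace Y_top. unshift \<alpha> \<in> A n}" for n
    by (intro openin_continuous_map_preimage[OF cont_shift(2)] openin_Int A open_diff)
  show "openin X_top {x. \<exists>y\<in>V. f_map x = Some y}"
    unfolding openin_X 1 using o1 openin_U_set by (auto intro!: openin_Int)
  show "openin X_top {y. \<exists>x\<in>V. f_map x = Some y}"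
    unfolding openin_X 2 using o2 open_diff by (auto intro!: openin_Int)
qed

lemma g_map_partial_homeo: "g_map \<in> partial_homeos X_top"
  unfolding partial_homeos_iff
proof (intro conjI allI impI)
  show "dom g_map \<subseteq> topspace X_top" "ran g_map \<subseteq> topspace X_top"
    by (auto simp: topspace_X dom_def ran_def g_Some X_set_def)
  show "x = x'" if "g_map x = Some y" "g_map x' = Some y" for x x' y
    using that by (auto simp: g_Some)
  fix V assume V: "openin X_top V"
  define A where "A n = {\<alpha>. (n, \<alpha>) \<in> V}" for n
  have A: "openin Y_top (A n)" "A n \<subseteq> U_set n" for n using V by (auto simp: openin_X A_def)
  have 1: "{\<alpha>. (n, \<alpha>) \<in> {x. \<exists>y\<in>V. g_map x = Some y}} = U_set n \<inter> A (n+1)" for n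
    using A(2)[of "n+1"] by (auto simp: g_Some A_def)
  have 2: "{\<alpha>. (n, \<alpha>) \<in> {y. \<exists>x\<in>V. g_map x = Some y}} =
     (if n = 0 then {} else U_set n \<inter> A (n - 1))" for n
    using A(2)[of "n-1"] by (cases n) (auto simp: g_Some A_def)
  show "openin X_top {x. \<exists>y\<in>V. g_map x = Some y}"
    unfolding openin_X 1 using A openin_U_set by (auto intro!: openin_Int)
  show "openin X_top {y. \<exists>x\<in>V. g_map x = Some y}"
    unfolding openin_X 2 using A openin_U_set by (auto intro!: openin_Int)
qed

corollary pseudogroup_G_pg: "pseudogroup X_top G_pg" and f_map_G_pg: "f_map \<in> G_pg"
  and g_map_G_pg: "g_map \<in> G_pg"
proof -
  have S: "{f_map, g_map} \<subseteq> partial_homeos X_top"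
    using f_map_partial_homeo g_map_partial_homeo by simp
  show "pseudogroup X_top G_pg" "f_map \<in> G_pg" "g_map \<in> G_pg"
    using pseudogroup_generated_by(1,2)[OF S] by (simp_all add: G_pg_def)
qed

end

theory Submission imports Defs
begin

text \<open>
  The guards on \<^const>\<open>f_map\<close> and \<^const>\<open>g_map\<close> do not show in the orbits: on the bottom
  level \<open>{0} \<times> Y\<close> the pseudogroup has exactly the orbits of the full shift.

  Every point \<open>(n, \<alpha>)\<close> can be moved down to \<open>(0, \<alpha>)\<close> by inverting \<^const>\<open>g_map\<close>. To get from
  \<open>(0, \<alpha>)\<close> to \<open>(0, shift \<alpha>)\<close> when \<open>shift \<alpha> \<noteq> 0\<close>, take the largest \<open>m\<close> with \<open>shift \<alpha> \<in> U_set m\<close>;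
  shifting moves the central block of zeros by only one place, so \<open>\<alpha> \<in> U_set (m - 1)\<close>, and on
  level \<open>m - 1\<close> the map \<^const>\<open>f_map\<close> is defined at \<open>\<alpha>\<close>: climb, shift, descend
  (\<open>reach_shift\<close>); for \<open>m = 0\<close> one shifts on level \<open>0\<close> itself.
  Conversely, elements of the pseudogroup preserve every shift-invariant set of sequences,
  because the generators do and partial homeomorphisms preserving a set form a
  pseudogroup (\<open>G_pg_preserves_shift_invariant\<close>).

  Both claims are then those for the full shift on two symbols. Transitivity: a sequence can agree
  with one given sequence on a window and with another one on a later window. Density of periodic
  orbits, with \<open>U = {0} \<times> Y\<close>: repeating a window periodically approximates any sequence, and the
  sequences of period \<open>p\<close> form a finite shift-invariant set, so the orbits inside it are finite.
\<close>

section \<open>Orbits of a pseudogroup\<close>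

definition reach :: "('a \<rightharpoonup> 'a) set \<Rightarrow> 'a \<Rightarrow> 'a \<Rightarrow> bool" where
  "reach G x y \<longleftrightarrow> (\<exists>h\<in>G. h x = Some y)"

lemma reachI: "h \<in> G \<Longrightarrow> h x = Some y \<Longrightarrow> reach G x y"
  by (auto simp: reach_def)

lemma orbit_of_eq_reach: "orbit_of G x = {y. reach G x y}"
  by (force simp: orbit_of_def reach_def)

lemma reach_refl:
  assumes "pseudogroup X G" "x \<in> topspace X"
  shows "reach G x x"
  using pseudogroup_id[OF assms(1)] assms(2) by (intro reachI[of "Some |` topspace X"]) simp_all

lemma reach_sym:
  assumes G: "pseudogroup X G" and "reach G x y"
  shows "reach G y x"
proof -
  obtain h where h: "h \<in> G" "h x = Some y" using assms(2) by (auto simp: reach_def)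
  moreover have "h \<in> partial_homeos X" using pseudogroup_subset[OF G] h by blast
  ultimately show ?thesis
    using pseudogroup_pinv[OF G] by (intro reachI[of "pinv h"]) (auto simp: pinv_eq_Some_iff)
qed

lemma reach_trans:
  assumes G: "pseudogroup X G" and "reach G x y" "reach G y z"
  shows "reach G x z"
proof -
  obtain h k where "h \<in> G" "h x = Some y" "k \<in> G" "k y = Some z"
    using assms(2,3) by (auto simp: reach_def)
  then show ?thesis
    using pseudogroup_comp[OF G] by (intro reachI[of "k \<circ>\<^sub>m h"]) auto
qed

lemma topologically_transitiveI:
  assumes "\<And>U V. openin X U \<Longrightarrow> U \<noteq> {} \<Longrightarrow> openin X V \<Longrightarrow> V \<noteq> {} \<Longrightarrow>
    \<exists>x\<in>U. \<exists>y\<in>V. reach G x y"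
  shows "topologically_transitive X G"
  unfolding topologically_transitive_def
proof (intro allI impI)
  fix U V assume "openin X U \<and> U \<noteq> {} \<and> openin X V \<and> V \<noteq> {}"
  then obtain x y h where "x \<in> U" "y \<in> V" "h \<in> G" "h x = Some y"
    using assms[of U V] by (auto simp: reach_def)
  then show "\<exists>h\<in>G. (\<lambda>x. the (h x)) ` (U \<inter> dom h) \<inter> V \<noteq> {}"
    by (intro bexI[of _ h]) force+
qed

text \<open>The pseudogroup to compare with when bounding the orbits of a generated pseudogroup: an
  invariant set of the generators is thereby an invariant set of everything they generate. The
  equivalence, rather than an implication, makes the family closed under inversion.\<close>

lemma pseudogroup_preserving_set:
  "pseudogroup X {h \<in> partial_homeos X. \<forall>x y. h x = Some y \<longrightarrow> (x \<in> S \<longleftrightarrow> y \<in> S)}"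
  (is "pseudogroup X ?H")
  unfolding pseudogroup_def
proof (intro conjI ballI allI impI)
  note P = pseudogroup_partial_homeos[of X]
  show "Some |` topspace X \<in> ?H"
    using pseudogroup_id[OF P] by (auto simp: restrict_map_def split: if_splits)
  show "pinv h \<in> ?H" if "h \<in> ?H" for h
    using that pseudogroup_pinv[OF P] by (auto simp: pinv_eq_Some_iff)
  show "k \<circ>\<^sub>m h \<in> ?H" if "h \<in> ?H" "k \<in> ?H" for h k
    using that pseudogroup_comp[OF P, of h k] by (auto simp: map_comp_Some_iff)
  show "h |` W \<in> ?H" if "h \<in> ?H" "openin X W \<and> W \<subseteq> dom h" for h W
    using that pseudogroup_restrict[OF P, of h W] by (auto simp: restrict_map_def split: if_splits)
  show "h \<in> ?H" if h: "h \<in> partial_homeos X"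
    and loc: "\<forall>x\<in>dom h. \<exists>W. openin X W \<and> x \<in> W \<and> W \<subseteq> dom h \<and> h |` W \<in> ?H" for h
  proof -
    have "x \<in> S \<longleftrightarrow> y \<in> S" if xy: "h x = Some y" for x y
    proof -
      obtain W where "x \<in> W" "h |` W \<in> ?H" using loc xy by blast
      moreover from this have "(h |` W) x = Some y" using xy by simp
      ultimately show ?thesis by blast
    qed
    with h show ?thesis by blast
  qed
qed auto

section \<open>Orbits of the shift pseudogroup\<close>

lemmas reach_G_trans = reach_trans[OF pseudogroup_G_pg]
  and reach_G_sym = reach_sym[OF pseudogroup_G_pg]

lemma U_set_mono: "m \<le> n \<Longrightarrow> U_set n \<subseteq> U_set m"
  by (auto simp: U_set_def)

lemma reach_level_0: "\<alpha> \<in> U_set n \<Longrightarrow> reach G_pg (0, \<alpha>) (n, \<alpha>)"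
proof (induction n)
  case 0
  then show ?case by (intro reach_refl[OF pseudogroup_G_pg]) (simp add: topspace_X X_set_def)
next
  case (Suc n)
  have \<alpha>: "\<alpha> \<in> U_set n" using Suc.prems U_set_mono[of n "Suc n"] by auto
  have "reach G_pg (n, \<alpha>) (Suc n, \<alpha>)"
    using Suc.prems \<alpha> by (intro reachI[OF g_map_G_pg]) (simp add: g_Some)
  with Suc.IH[OF \<alpha>] show ?case by (rule reach_G_trans)
qed

text \<open>A nonzero entry bounds the levels available, so there is a highest one.\<close>

lemma nonzero_highest_level:
  assumes "\<alpha> \<in> topspace Y_top" "\<alpha> i \<noteq> 0"
  obtains m where "\<alpha> \<in> U_set m" "\<alpha> \<notin> U_set (Suc m)"
proof -
  have "\<alpha> \<notin> U_set (Suc (nat \<bar>i\<bar>))" using assms(2) by (auto simp: U_set_def intro!: exI[of _ i])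
  moreover have "\<alpha> \<in> U_set 0" using assms(1) by (simp add: U_set_def)
  ultimately have "\<exists>m. \<alpha> \<in> U_set m \<and> \<alpha> \<notin> U_set (Suc m)"
    using nat_induct[of "\<lambda>m. \<alpha> \<in> U_set m"] by blast
  then show ?thesis using that by blast
qed

lemma U_set_if_shift: "shift \<alpha> \<in> U_set m \<Longrightarrow> \<alpha> \<in> U_set (m - 1)"
proof -
  assume s: "shift \<alpha> \<in> U_set m"
  have "\<alpha> i = 0" if "\<bar>i\<bar> < int (m - 1)" for i
  proof -
    have "shift \<alpha> (i - 1) = 0" using s that by (auto simp: U_set_def)
    then show ?thesis by (simp add: shift_def)
  qed
  with s show ?thesis by (auto simp: U_set_def shift_Y)
qed

text \<open>This is why the guard \<open>shift \<alpha> \<notin> U_set (n + 2)\<close> does not cut any shift orbit: it fails on the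
  levels at least two below the highest one available for \<open>shift \<alpha>\<close>, but one can shift on the
  level just under that highest one and come back. The zero sequence has no highest level, but it
  is fixed by the shift.\<close>

lemma reach_shift:
  assumes "\<alpha> \<in> topspace Y_top"
  shows "reach G_pg (0, \<alpha>) (0, shift \<alpha>)"
proof (cases "\<forall>i. shift \<alpha> i = 0")
  case True
  then have "\<alpha> i = 0" for i by (metis shift_def diff_add_cancel)
  then have "shift \<alpha> = \<alpha>" by (auto simp: shift_def)
  then show ?thesis
    using reach_level_0[of \<alpha> 0] assms by (simp add: U_set_def)
next
  case False
  then obtain m where m: "shift \<alpha> \<in> U_set m" "shift \<alpha> \<notin> U_set (Suc m)"
    using nonzero_highest_level assms shift_Y by metis
  \<comment> \<open>For \<open>m = 0\<close> the truncated difference is again \<open>0\<close>, where the shift can be performed directly.\<close>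
  let ?n = "m - 1"
  have \<alpha>: "\<alpha> \<in> U_set ?n" using m(1) by (rule U_set_if_shift)
  have s: "shift \<alpha> \<in> U_set ?n" "shift \<alpha> \<notin> U_set (?n + 2)"
    using m U_set_mono[of ?n m] U_set_mono[of "Suc m" "?n + 2"] by force+
  have "reach G_pg (?n, \<alpha>) (?n, shift \<alpha>)"
    using \<alpha> s by (intro reachI[OF f_map_G_pg]) (simp add: f_Some)
  then show ?thesis
    using reach_level_0[OF \<alpha>] reach_G_sym[OF reach_level_0[OF s(1)]] reach_G_trans by blast
qed

lemma shift_funpow: "(shift ^^ k) \<alpha> i = \<alpha> (i + int k)"
  by (induction k arbitrary: i) (simp_all add: shift_def algebra_simps)

lemma reach_shift_funpow:
  assumes "\<alpha> \<in> topspace Y_top"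
  shows "reach G_pg (0, \<alpha>) (0, (shift ^^ k) \<alpha>)"
proof (induction k)
  case 0
  then show ?case using reach_level_0[of \<alpha> 0] assms by (simp add: U_set_def)
next
  case (Suc k)
  have "(shift ^^ k) \<alpha> \<in> topspace Y_top"
    using assms by (simp add: topspace_Y shift_funpow)
  from reach_shift[OF this] Suc.IH show ?case using reach_G_trans by simp
qed

lemma G_pg_preserves_shift_invariant:
  assumes "\<And>\<alpha>. shift \<alpha> \<in> Q \<longleftrightarrow> \<alpha> \<in> Q" and "reach G_pg p q"
  shows "snd p \<in> Q \<longleftrightarrow> snd q \<in> Q"
proof -
  let ?H = "{h \<in> partial_homeos X_top. \<forall>x y. h x = Some y \<longrightarrow> (x \<in> UNIV \<times> Q \<longleftrightarrow> y \<in> UNIV \<times> Q)}"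
  have "{f_map, g_map} \<subseteq> ?H"
    using f_map_partial_homeo g_map_partial_homeo assms(1) by (auto simp: f_Some g_Some)
  with pseudogroup_preserving_set have "G_pg \<subseteq> ?H"
    unfolding G_pg_def generated_by_def by blast
  moreover obtain h where "h \<in> G_pg" "h p = Some q" using assms(2) by (auto simp: reach_def)
  ultimately have "p \<in> UNIV \<times> Q \<longleftrightarrow> q \<in> UNIV \<times> Q" by blast
  then show ?thesis by (cases p; cases q) simp
qed

section \<open>The full shift\<close>

text \<open>Symmetric windows suffice because the basic open sets of the product constrain only finitely
  many coordinates.\<close>

lemma openin_Y_window:
  assumes "openin Y_top A" "\<alpha> \<in> A"
  obtains N :: nat where
    "\<And>\<beta>. \<beta> \<in> topspace Y_top \<Longrightarrow> (\<And>i. \<bar>i\<bar> \<le> int N \<Longrightarrow> \<beta> i = \<alpha> i) \<Longrightarrow> \<beta> \<in> A"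
proof -
  obtain B where B: "finite {i. B i \<noteq> {0, 1::nat}}" "\<alpha> \<in> Pi\<^sub>E UNIV B" "Pi\<^sub>E UNIV B \<subseteq> A"
    using assms by (auto simp: Y_top_def openin_product_topology_alt)
  define I where "I = {i. B i \<noteq> {0, 1::nat}}"
  have fin: "finite ((\<lambda>i. nat \<bar>i\<bar>) ` I)" using B(1) by (simp add: I_def)
  define N where "N = Max (insert 0 ((\<lambda>i. nat \<bar>i\<bar>) ` I))"
  have N: "\<bar>i\<bar> \<le> int N" if "i \<in> I" for i
  proof -
    have "nat \<bar>i\<bar> \<le> N" unfolding N_def using fin that by (intro Max_ge) auto
    then show ?thesis by linarith
  qed
  show ?thesis
  proof (rule that)
    fix \<beta> assume \<beta>: "\<beta> \<in> topspace Y_top" "\<And>i. \<bar>i\<bar> \<le> int N \<Longrightarrow> \<beta> i = \<alpha> i"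
    have "\<beta> i \<in> B i" for i
    proof (cases "i \<in> I")
      case True
      then show ?thesis using \<beta>(2)[OF N] B(2) by (auto simp: PiE_def Pi_def)
    next
      case False
      then show ?thesis using \<beta>(1) by (auto simp: I_def topspace_Y)
    qed
    then show "\<beta> \<in> A" using B(3) by (auto simp: PiE_def)
  qed
qed

lemma shift_transitive:
  assumes A: "openin Y_top A" "A \<noteq> {}" and B: "openin Y_top B" "B \<noteq> {}"
  obtains \<gamma> k where "\<gamma> \<in> A" "(shift ^^ k) \<gamma> \<in> B"
proof -
  obtain \<alpha> \<beta> where ab: "\<alpha> \<in> A" "\<beta> \<in> B" using A B by blast
  obtain M where M: "\<And>\<gamma>. \<gamma> \<in> topspace Y_top \<Longrightarrow> (\<And>i. \<bar>i\<bar> \<le> int M \<Longrightarrow> \<gamma> i = \<alpha> i) \<Longrightarrow> \<gamma> \<in> A"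
    using openin_Y_window[OF A(1) ab(1)] by blast
  obtain N where N: "\<And>\<gamma>. \<gamma> \<in> topspace Y_top \<Longrightarrow> (\<And>i. \<bar>i\<bar> \<le> int N \<Longrightarrow> \<gamma> i = \<beta> i) \<Longrightarrow> \<gamma> \<in> B"
    using openin_Y_window[OF B(1) ab(2)] by blast
  have Y: "\<alpha> \<in> topspace Y_top" "\<beta> \<in> topspace Y_top"
    using ab A(1) B(1) openin_subset by blast+
  \<comment> \<open>Around \<open>0\<close>, \<open>(shift ^^ k) \<gamma>\<close> reads \<open>\<gamma>\<close> around \<open>k\<close>, just to the right of the first window.\<close>
  define k where "k = M + N + 1"
  define \<gamma> where "\<gamma> i = (if i \<le> int M then \<alpha> i else \<beta> (i - int k))" for i
  have \<gamma>: "\<gamma> \<in> topspace Y_top" "(shift ^^ k) \<gamma> \<in> topspace Y_top"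
    using Y by (simp_all add: topspace_Y shift_funpow \<gamma>_def)
  have "\<gamma> i = \<alpha> i" if "\<bar>i\<bar> \<le> int M" for i
  proof -
    have "i \<le> int M" using that by linarith
    then show ?thesis by (simp add: \<gamma>_def)
  qed
  from M[OF \<gamma>(1) this] have "\<gamma> \<in> A" .
  have "(shift ^^ k) \<gamma> i = \<beta> i" if "\<bar>i\<bar> \<le> int N" for i
  proof -
    have "\<not> i + int k \<le> int M" using that unfolding k_def by linarith
    then show ?thesis by (simp add: shift_funpow \<gamma>_def)
  qed
  from N[OF \<gamma>(2) this] have "(shift ^^ k) \<gamma> \<in> B" .
  with \<open>\<gamma> \<in> A\<close> show ?thesis by (rule that)
qed

text \<open>Periodicity is phrased through remainders rather than through \<open>\<alpha> (i + p) = \<alpha> i\<close>, so that a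
  periodic sequence is visibly determined by its values on \<open>{0..<p}\<close>.\<close>

definition periodic_seqs :: "int \<Rightarrow> (int \<Rightarrow> nat) set" where
  "periodic_seqs p = {\<alpha> \<in> topspace Y_top. \<forall>i. \<alpha> (i mod p) = \<alpha> i}"

lemma finite_periodic_seqs:
  assumes "p > 0"
  shows "finite (periodic_seqs p)"
proof (rule finite_subset)
  show "periodic_seqs p \<subseteq> (\<lambda>w i. w (i mod p)) ` Pi\<^sub>E {0..<p} (\<lambda>_. {0, 1})"
  proof
    fix \<alpha> assume \<alpha>: "\<alpha> \<in> periodic_seqs p"
    have "restrict \<alpha> {0..<p} \<in> Pi\<^sub>E {0..<p} (\<lambda>_. {0, 1})"
      using \<alpha> by (auto simp: periodic_seqs_def topspace_Y)
    moreover have "\<alpha> = (\<lambda>i. restrict \<alpha> {0..<p} (i mod p))"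
      using \<alpha> assms by (auto simp: periodic_seqs_def)
    ultimately show "\<alpha> \<in> (\<lambda>w i. w (i mod p)) ` Pi\<^sub>E {0..<p} (\<lambda>_. {0, 1})" by blast
  qed
qed (simp add: finite_PiE)

lemma shift_periodic_seqs: "shift \<alpha> \<in> periodic_seqs p \<longleftrightarrow> \<alpha> \<in> periodic_seqs p"
proof
  assume s: "shift \<alpha> \<in> periodic_seqs p"
  then have per: "\<alpha> (i mod p + 1) = \<alpha> (i + 1)" for i by (auto simp: periodic_seqs_def shift_def)
  have "\<alpha> (i mod p) = \<alpha> i" for i
    using per[of "i - 1"] per[of "i mod p - 1"] by (simp add: mod_diff_left_eq)
  then show "\<alpha> \<in> periodic_seqs p" using s by (simp add: periodic_seqs_def shift_Y)
next
  assume \<alpha>: "\<alpha> \<in> periodic_seqs p"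
  then have per: "\<alpha> (i mod p) = \<alpha> i" for i by (simp add: periodic_seqs_def)
  have "\<alpha> (i mod p + 1) = \<alpha> (i + 1)" for i
    using per[of "i mod p + 1"] per[of "i + 1"] by (simp add: mod_add_left_eq)
  then show "shift \<alpha> \<in> periodic_seqs p" using \<alpha>
    by (simp add: periodic_seqs_def shift_Y shift_def[of \<alpha>] flip: shift_Y[of \<alpha>])
qed

lemma periodic_seqs_dense:
  assumes "openin Y_top A" "A \<noteq> {}"
  obtains p \<beta> where "p > 0" "\<beta> \<in> periodic_seqs p" "\<beta> \<in> A"
proof -
  obtain \<alpha> where \<alpha>: "\<alpha> \<in> A" using assms by blast
  obtain N where N: "\<And>\<beta>. \<beta> \<in> topspace Y_top \<Longrightarrow> (\<And>i. \<bar>i\<bar> \<le> int N \<Longrightarrow> \<beta> i = \<alpha> i) \<Longrightarrow> \<beta> \<in> A"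
    using openin_Y_window[OF assms(1) \<alpha>] by blast
  have Y: "\<alpha> \<in> topspace Y_top" using \<alpha> assms(1) openin_subset by blast
  \<comment> \<open>The window has length \<open>p\<close>; the argument of \<open>\<alpha>\<close> is the representative of \<open>i\<close> modulo \<open>p\<close> in it.\<close>
  define p where "p = 2 * int N + 1"
  define \<beta> where "\<beta> i = \<alpha> ((i + int N) mod p - int N)" for i
  have "\<beta> \<in> topspace Y_top" using Y by (simp add: topspace_Y \<beta>_def)
  moreover have "\<beta> i = \<alpha> i" if "\<bar>i\<bar> \<le> int N" for i
    using that by (simp add: \<beta>_def p_def)
  ultimately have "\<beta> \<in> A" by (rule N)
  moreover have "\<beta> \<in> periodic_seqs p"
    using \<open>\<beta> \<in> topspace Y_top\<close> by (simp add: periodic_seqs_def \<beta>_def mod_add_left_eq)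
  moreover have "p > 0" by (simp add: p_def)
  ultimately show ?thesis using that by blast
qed

section \<open>Transitivity and density of periodic orbits\<close>

lemma topologically_transitive_G_pg: "topologically_transitive X_top G_pg"
proof (rule topologically_transitiveI)
  fix U V assume UV: "openin X_top U" "U \<noteq> {}" "openin X_top V" "V \<noteq> {}"
  then obtain n m where nm: "{\<alpha>. (n, \<alpha>) \<in> U} \<noteq> {}" "{\<alpha>. (m, \<alpha>) \<in> V} \<noteq> {}" by auto
  have o: "openin Y_top {\<alpha>. (n, \<alpha>) \<in> U}" "openin Y_top {\<alpha>. (m, \<alpha>) \<in> V}"
    using UV by (simp_all add: openin_X)
  obtain \<gamma> k where g: "(n, \<gamma>) \<in> U" "(m, (shift ^^ k) \<gamma>) \<in> V"
    using shift_transitive[OF o(1) nm(1) o(2) nm(2)] by auto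
  then have u: "\<gamma> \<in> U_set n" "(shift ^^ k) \<gamma> \<in> U_set m"
    using UV by (auto simp: openin_X)
  then have "\<gamma> \<in> topspace Y_top" by (simp add: U_set_def)
  then have "reach G_pg (n, \<gamma>) (m, (shift ^^ k) \<gamma>)"
    by (intro reach_G_trans[OF reach_G_sym[OF reach_level_0[OF u(1)]]]
        reach_G_trans[OF reach_shift_funpow reach_level_0[OF u(2)]])
  with g show "\<exists>x\<in>U. \<exists>y\<in>V. reach G_pg x y" by blast
qed

lemma finite_orbit_periodic:
  assumes "p > 0" "\<alpha> \<in> periodic_seqs p"
  shows "finite (orbit_of (pg_restrict G_pg ({0} \<times> Q)) (0, \<alpha>))"
proof (rule finite_subset)
  show "orbit_of (pg_restrict G_pg ({0} \<times> Q)) (0, \<alpha>) \<subseteq> {0} \<times> periodic_seqs p"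
  proof
    fix q assume "q \<in> orbit_of (pg_restrict G_pg ({0} \<times> Q)) (0, \<alpha>)"
    then obtain h where h: "h \<in> G_pg" "ran h \<subseteq> {0} \<times> Q" "h (0, \<alpha>) = Some q"
      by (auto simp: orbit_of_eq_reach reach_def pg_restrict_def)
    then have "snd q \<in> periodic_seqs p"
      using G_pg_preserves_shift_invariant[OF shift_periodic_seqs reachI[OF h(1,3)]] assms(2) by simp
    moreover have "q \<in> ran h" using h(3) by (rule ranI)
    ultimately show "q \<in> {0} \<times> periodic_seqs p" using h(2) by auto
  qed
qed (simp add: finite_periodic_seqs[OF assms(1)])

lemma density_of_periodic_orbits_G_pg: "density_of_periodic_orbits X_top G_pg"
proof -
  let ?U = "{0::nat} \<times> topspace Y_top"
  let ?P = "\<Union> {C. \<exists>x\<in>?U. C = orbit_of (pg_restrict G_pg ?U) x \<and> finite C}"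
  have U0: "U_set 0 = topspace Y_top" by (simp add: U_set_def)
  have slice: "{\<alpha>. (n, \<alpha>) \<in> ?U} = (if n = 0 then topspace Y_top else {})" for n by auto
  have oU: "openin X_top ?U" unfolding openin_X slice by (simp add: U0)
  have "\<exists>y\<in>?U. reach G_pg x y" if "x \<in> topspace X_top" for x
  proof -
    obtain n \<alpha> where x: "x = (n, \<alpha>)" "\<alpha> \<in> U_set n"
      using \<open>x \<in> topspace X_top\<close> by (auto simp: topspace_X X_set_def)
    then have "(0, \<alpha>) \<in> ?U" by (simp add: U_set_def)
    with reach_G_sym[OF reach_level_0[OF x(2)]] x(1) show ?thesis by blast
  qed
  then have meets: "\<forall>x\<in>topspace X_top. orbit_of G_pg x \<inter> ?U \<noteq> {}"
    unfolding orbit_of_eq_reach by blast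
  have self: "x \<in> orbit_of (pg_restrict G_pg ?U) x" if "x \<in> ?U" for x
  proof -
    have "(Some |` topspace X_top) |` ?U \<in> G_pg"
    proof (rule pseudogroup_restrict[OF pseudogroup_G_pg pseudogroup_id[OF pseudogroup_G_pg] oU])
      show "?U \<subseteq> dom (Some |` topspace X_top)"
        using openin_subset[OF oU] by (simp add: dom_def restrict_map_def)
    qed
    then have "Some |` ?U \<in> G_pg"
      using openin_subset[OF oU] by (simp add: Int_absorb1)
    then have "Some |` ?U \<in> pg_restrict G_pg ?U"
      by (auto simp: pg_restrict_def ran_def restrict_map_def split: if_splits)
    then show ?thesis
      using that by (auto simp: orbit_of_eq_reach intro: reachI)
  qed
  have top: "topspace (subtopology X_top ?U) = ?U"
    using openin_subset[OF oU] by (simp add: Int_absorb1)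
  have "subtopology X_top ?U closure_of ?P = ?U"
  proof (rule equalityI)
    show "subtopology X_top ?U closure_of ?P \<subseteq> ?U"
      using closure_of_subset_topspace[of "subtopology X_top ?U" ?P] unfolding top .
    show "?U \<subseteq> subtopology X_top ?U closure_of ?P"
    proof
      fix x assume x: "x \<in> ?U"
      show "x \<in> subtopology X_top ?U closure_of ?P"
        unfolding in_closure_of top
      proof (intro conjI allI impI x)
        fix T assume T: "x \<in> T \<and> openin (subtopology X_top ?U) T"
        then have oT: "openin X_top T" "T \<subseteq> ?U" using oU by (simp_all add: openin_open_subtopology)
        have "openin Y_top {\<alpha>. (0, \<alpha>) \<in> T}" "{\<alpha>. (0, \<alpha>) \<in> T} \<noteq> {}"
          using oT x T by (auto simp: openin_X)
        then obtain p \<beta> where b: "p > 0" "\<beta> \<in> periodic_seqs p" "\<beta> \<in> {\<alpha>. (0, \<alpha>) \<in> T}"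
          by (rule periodic_seqs_dense)
        have "(0, \<beta>) \<in> T" using b(3) by simp
        from oT(2) this have \<beta>U: "(0, \<beta>) \<in> ?U" by (rule subsetD)
        let ?C = "orbit_of (pg_restrict G_pg ?U) (0, \<beta>)"
        have "finite ?C" by (rule finite_orbit_periodic[OF b(1,2)])
        with \<beta>U have "?C \<in> {C. \<exists>x\<in>?U. C = orbit_of (pg_restrict G_pg ?U) x \<and> finite C}"
          by (intro CollectI bexI[of _ "(0, \<beta>)"] conjI refl)
        from UnionI[OF this self[OF \<beta>U]] \<open>(0, \<beta>) \<in> T\<close> show "\<exists>y. y \<in> ?P \<and> y \<in> T" by blast
      qed
    qed
  qed
  with oU meets show ?thesis
    unfolding density_of_periodic_orbits_def by (intro exI[of _ ?U] conjI)
qed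

theorem corollary3p22:
  "topologically_transitive X_top G_pg \<and> density_of_periodic_orbits X_top G_pg"
  using topologically_transitive_G_pg density_of_periodic_orbits_G_pg by blast

end
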